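(* Let $q$ be a prime power and $n,r$ positive integers with $n\ge 2r+1$. Let $P$ be the matrix with rows indexed by the $r$-dimensional subspaces of $\mathbb F_q^n$ and columns indexed by the $1$-dimensional subspaces (lines) of $\mathbb F_q^n$, with $P_{S,\ell}=[r]_q-[n]_q$ if $\ell\subseteq S$ and $P_{S,\ell}=[r]_q$ if $\ell\cap S=\{0\}$, where $[k]_q=\frac{q^k-1}{q-1}$. For each vertex $S$ of the $q$-Kneser graph $qK_{n:r}$ let $p_S\in\mathbb R^{[n]_q}$ be the transpose of the $S$-row of $P$. Then, viewing $qK_{n:r}$ as a tensegrity graph with no cables (each edge a bar or a strut), the tensegrity framework $qK_{n:r}(\mathbf p)$ is universally completable.
   Context: The $q$-Kneser graph $qK_{n:r}$ has as vertices the $r$-dimensional subspaces of $\mathbb F_q^n$, two being adjacent if they intersect trivially. A tensegrity graph is a graph whose edge set is partitioned into bars $B$, cables $C$ and struts $S$; a tensegrity framework assigns real column vectors $p_v$ to its vertices. For frameworks $G(\mathbf p)$ and $G(\mathbf q)$ (the $q_v$ may lie in a real space of any dimension), $G(\mathbf p)$ dominates $G(\mathbf q)$ if $q_u^Tq_v=p_u^Tp_v$ for $uv\in B$ and for $u=v$, $q_u^Tq_v\ge p_u^Tp_v$ for $uv\in C$, and $q_u^Tq_v\le p_u^Tp_v$ for $uv\in S$. The framework is universally completable if every framework it dominates has the same Gram matrix (matrix of pairwise inner products). *)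

theory Defs
  imports "HOL-Analysis.Analysis"
begin

section \<open>Tensegrity graphs and frameworks\<close>

text \<open>Edges are unordered pairs \<open>{u, v}\<close>.\<close>

record 'v tensegrity_graph =
  verts :: "'v set"
  bars :: "'v set set"
  cables :: "'v set set"
  struts :: "'v set set"

definition tensegrity_graph_on :: "'v set \<Rightarrow> 'v set set \<Rightarrow> 'v tensegrity_graph \<Rightarrow> bool" where
  "tensegrity_graph_on V E G \<longleftrightarrow>
     verts G = V \<and> bars G \<union> cables G \<union> struts G = E \<and>
     bars G \<inter> cables G = {} \<and> bars G \<inter> struts G = {} \<and> cables G \<inter> struts G = {}"

text \<open>
  A framework consists of a finite index set \<open>I\<close> and vectors \<open>p v\<close> in \<open>\<real>\<^sup>I\<close>: only the
  coordinates \<open>p v i\<close> with \<open>i \<in> I\<close> are relevant.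
\<close>

definition gram :: "'i set \<Rightarrow> ('v \<Rightarrow> 'i \<Rightarrow> real) \<Rightarrow> 'v \<Rightarrow> 'v \<Rightarrow> real" where
  "gram I p u v = (\<Sum>i\<in>I. p u i * p v i)"

definition dominates ::
  "'v tensegrity_graph \<Rightarrow> 'i set \<Rightarrow> ('v \<Rightarrow> 'i \<Rightarrow> real) \<Rightarrow> 'j set \<Rightarrow> ('v \<Rightarrow> 'j \<Rightarrow> real) \<Rightarrow> bool" where
  "dominates G I p J p' \<longleftrightarrow>
     (\<forall>u\<in>verts G. gram J p' u u = gram I p u u) \<and>
     (\<forall>u v. {u, v} \<in> bars G \<longrightarrow> gram J p' u v = gram I p u v) \<and>
     (\<forall>u v. {u, v} \<in> cables G \<longrightarrow> gram J p' u v \<ge> gram I p u v) \<and>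
     (\<forall>u v. {u, v} \<in> struts G \<longrightarrow> gram J p' u v \<le> gram I p u v)"

text \<open>The dominated frameworks range over \<open>\<real>\<^sup>d\<close> for every \<open>d\<close>.\<close>

definition universally_completable ::
  "'v tensegrity_graph \<Rightarrow> 'i set \<Rightarrow> ('v \<Rightarrow> 'i \<Rightarrow> real) \<Rightarrow> bool" where
  "universally_completable G I p \<longleftrightarrow>
     (\<forall>(d::nat) (p' :: 'v \<Rightarrow> nat \<Rightarrow> real). dominates G I p {..<d} p' \<longrightarrow>
        (\<forall>u\<in>verts G. \<forall>v\<in>verts G. gram {..<d} p' u v = gram I p u v))"

section \<open>The \<open>q\<close>-Kneser graph\<close>

text \<open>
  The field \<open>\<F>\<^sub>q\<close> is a finite field type \<open>'a\<close>, so \<open>q = CARD('a)\<close> is automatically a prime power,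
  and \<open>\<F>\<^sub>q\<^sup>n\<close> is \<open>'a ^ 'n\<close> with \<open>n = CARD('n)\<close>.
\<close>

definition subspaces_of_dim :: "nat \<Rightarrow> ('a::{field,finite} ^ 'n::finite) set set" where
  "subspaces_of_dim k = {S. vec.subspace S \<and> vec.dim S = k}"

definition qkneser_edges :: "nat \<Rightarrow> ('a::{field,finite} ^ 'n::finite) set set set" where
  "qkneser_edges r =
     {{S, T} | S T. S \<in> subspaces_of_dim r \<and> T \<in> subspaces_of_dim r \<and> S \<inter> T = {0}}"

definition q_number :: "nat \<Rightarrow> nat \<Rightarrow> real" where
  "q_number q k = (real q ^ k - 1) / (real q - 1)"

text \<open>
  The entry of \<open>P\<close> at an \<open>r\<close>-dimensional subspace \<open>S\<close> and a line \<open>L\<close>. A line not contained in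
  \<open>S\<close> meets \<open>S\<close> trivially, so the two cases are exhaustive.
\<close>

definition qkneser_P ::
  "nat \<Rightarrow> ('a::{field,finite} ^ 'n::finite) set \<Rightarrow> ('a ^ 'n) set \<Rightarrow> real" where
  "qkneser_P r S L =
     (if L \<subseteq> S then q_number CARD('a) r - q_number CARD('a) CARD('n)
      else q_number CARD('a) r)"

end

theory Submission
  imports Defs
begin

text \<open>
  Let \<open>V\<close> be the set of \<open>r\<close>-subspaces, \<open>A\<close> the adjacency operator of the \<open>q\<close>-Kneser graph and
  \<open>U\<^sub>j\<close> the span of the functions \<open>w\<^sub>T = (S \<mapsto> [T \<subseteq> S])\<close> on \<open>V\<close> with \<open>dim T \<le> j\<close>. Then \<open>A w\<^sub>T\<close> is a
  multiple of \<open>S \<mapsto> [T \<inter> S = {0}]\<close>, which is congruent to a multiple of \<open>w\<^sub>T\<close> modulo \<open>U\<^bsub>j-1\<^esub>\<close>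
  when \<open>dim T = j\<close>. So \<open>A\<close> acts on \<open>U\<^sub>j / U\<^bsub>j-1\<^esub>\<close> as a scalar \<open>\<lambda>\<^sub>j\<close>, and since \<open>A\<close> is symmetric and
  \<open>\<bar>\<lambda>\<^sub>j\<bar> < - \<lambda>\<^sub>1\<close> for \<open>j \<ge> 2\<close>, the form \<open>x \<mapsto> \<langle>(A - \<lambda>\<^sub>1) x, x\<rangle>\<close> is nonnegative and vanishes only
  on \<open>U\<^sub>1\<close>. It vanishes on the columns of \<open>P\<close>. Hence if \<open>q\<^sub>S\<close> is a dominated framework, the form
  vanishes on each of its coordinate functions and all edge inequalities are equalities.

  Both Gram matrices now have the form \<open>\<Sum>\<^bsub>L \<subseteq> S\<^esub> \<Sum>\<^bsub>M \<subseteq> T\<^esub> R L M\<close> over lines \<open>L\<close> and \<open>M\<close>, and their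
  difference vanishes for \<open>S = T\<close> and for \<open>S \<inter> T = {0}\<close>. As \<open>n \<ge> 2 r + 1\<close>, every line avoiding \<open>S\<close>
  lies in an \<open>(r + 1)\<close>-subspace \<open>U\<close> avoiding \<open>S\<close>, and a function on the lines of \<open>U\<close> whose sums over all
  hyperplanes of \<open>U\<close> vanish is zero. Applying this three times shows that \<open>R = 0\<close>.
\<close>

section \<open>Counting subspaces over a finite field\<close>

lemma card_span_insert:
  fixes B :: "('a::{field,finite} ^ 'n::finite) set"
  assumes "b \<notin> vec.span B"
  shows "card (vec.span (insert b B)) = CARD('a) * card (vec.span B)"
proof -
  let ?f = "\<lambda>(k, y). k *s b + y"
  have inj: "inj_on ?f (UNIV \<times> vec.span B)"
  proof (rule inj_onI, clarify)
    fix k y k' y'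
    assume y: "y \<in> vec.span B" "y' \<in> vec.span B" and eq: "k *s b + y = k' *s b + y'"
    have "(k - k') *s b = y' - y"
      using eq by (simp add: vec.scale_left_diff_distrib algebra_simps)
    then have "(k - k') *s b \<in> vec.span B"
      using y by (simp add: vec.span_diff)
    then have "(inverse (k - k') * (k - k')) *s b \<in> vec.span B"
      unfolding vec.scale_scale[symmetric] by (rule vec.span_scale)
    then have "k = k'"
      using assms by (metis eq_iff_diff_eq_0 left_inverse vec.scale_one)
    then show "k = k' \<and> y = y'" using eq by simp
  qed
  have "?f ` (UNIV \<times> vec.span B) = vec.span (insert b B)"
  proof -
    have "x \<in> ?f ` (UNIV \<times> vec.span B)" if "x - k *s b \<in> vec.span B" for x k
      using that by (intro image_eqI[of _ _ "(k, x - k *s b)"]) auto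
    then show ?thesis
      by (auto simp: vec.span_insert) (metis add_diff_cancel_left')
  qed
  then have "card (vec.span (insert b B)) = card ((UNIV :: 'a set) \<times> vec.span B)"
    using card_image[OF inj] by simp
  then show ?thesis by (simp add: card_cartesian_product)
qed

lemma card_vec_subspace:
  fixes S :: "('a::{field,finite} ^ 'n::finite) set"
  assumes "vec.subspace S"
  shows "card S = CARD('a) ^ vec.dim S"
proof -
  have indep: "card (vec.span B) = CARD('a) ^ card B" if "vec.independent B" for B :: "('a ^ 'n) set"
    using finite[of B] that
  proof (induction B rule: finite_induct)
    case (insert b B)
    then show ?case by (simp add: vec.independent_insert card_span_insert)
  qed simp
  obtain B where "B \<subseteq> S" "vec.independent B" "S \<subseteq> vec.span B" "card B = vec.dim S"
    using vec.basis_exists by blast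
  then show ?thesis using indep[of B] assms vec.span_subspace by metis
qed

lemma card_set_plus_subspaces:
  fixes S T :: "('a::{field,finite} ^ 'n::finite) set"
  assumes "vec.subspace S" "vec.subspace T" "S \<inter> T = {0}"
  shows "card {x + y |x y. x \<in> S \<and> y \<in> T} = CARD('a) ^ (vec.dim S + vec.dim T)"
proof -
  have "inj_on (\<lambda>(x, y). x + y) (S \<times> T)"
  proof (rule inj_onI, clarify)
    fix x y x' y' assume "x \<in> S" "x' \<in> S" "y \<in> T" "y' \<in> T" "x + y = x' + y'"
    moreover from this have "x - x' = y' - y" by (simp add: algebra_simps)
    ultimately have "x - x' \<in> S \<inter> T"
      using assms by (metis IntI vec.subspace_diff)
    then show "x = x' \<and> y = y'" using \<open>x - x' = y' - y\<close> assms(3) by auto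
  qed
  moreover have "{x + y |x y. x \<in> S \<and> y \<in> T} = (\<lambda>(x, y). x + y) ` (S \<times> T)" by auto
  ultimately have "card {x + y |x y. x \<in> S \<and> y \<in> T} = card (S \<times> T)"
    by (simp only: card_image)
  then show ?thesis using assms by (simp add: card_cartesian_product card_vec_subspace power_add)
qed

lemma dim_span_insert:
  fixes T :: "('a::{field,finite} ^ 'n::finite) set"
  assumes "vec.subspace T" "v \<notin> T"
  shows "vec.dim (vec.span (insert v T)) = Suc (vec.dim T)"
  using assms by (simp add: vec.dim_insert vec.span_eq_iff[THEN iffD2])

lemma span_insert_subset_iff:
  fixes T :: "('a::{field,finite} ^ 'n::finite) set"
  assumes "vec.subspace W"
  shows "vec.span (insert v T) \<subseteq> W \<longleftrightarrow> v \<in> W \<and> T \<subseteq> W"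
  using assms by (meson insert_subset order_trans vec.span_minimal vec.span_superset)

section \<open>Counting subspaces that avoid a given subspace\<close>

text \<open>One family serves all counts below: neighbours in the \<open>q\<close>-Kneser graph
  (\<open>U = UNIV\<close>), hyperplanes of \<open>U\<close> (\<open>S = {0}\<close>) and lines
  (\<open>k = 1\<close>).\<close>

definition avoiding_between ::
  "nat \<Rightarrow> ('a::{field,finite} ^ 'n::finite) set \<Rightarrow> ('a ^ 'n) set \<Rightarrow> ('a ^ 'n) set \<Rightarrow> ('a ^ 'n) set set" where
  "avoiding_between k S T U = {W \<in> subspaces_of_dim k. T \<subseteq> W \<and> W \<subseteq> U \<and> W \<inter> S = {0}}"

text \<open>The arguments \<open>k\<close>, \<open>s\<close>, \<open>i\<close>, \<open>u\<close>
  stand for the dimensions of \<open>W\<close>, \<open>S\<close>, \<open>T\<close>,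
  \<open>U\<close>. Factor \<open>j\<close> comes from enlarging a \<open>j\<close>-dimensional
  subspace by one vector: the numerator counts the vectors of \<open>U\<close> outside its sum with
  \<open>S\<close>, the denominator the vectors of \<open>W\<close> outside it. For
  \<open>i = k\<close> the empty product 1 counts \<open>T\<close> itself.\<close>

definition avoiding_number :: "real \<Rightarrow> nat \<Rightarrow> nat \<Rightarrow> nat \<Rightarrow> nat \<Rightarrow> real" where
  "avoiding_number q k s i u = (\<Prod>j=i..<k. (q ^ u - q ^ (s + j)) / (q ^ k - q ^ j))"

lemma card_field_gt_1: "1 < CARD('a::{field,finite})"
proof -
  have "card {0, 1 :: 'a} \<le> CARD('a)" by (intro card_mono) auto
  then show ?thesis by simp
qed

text \<open>Induction on \<open>k - vec.dim T\<close> with a double count of the pairs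
  \<open>(v, W)\<close> where \<open>v \<in> W\<close> lies outside \<open>S + T\<close>: the number
  of such \<open>v\<close> is the same for each \<open>W\<close>, and each \<open>v\<close> leaves
  the same problem with \<open>vec.span (insert v T)\<close> in place of \<open>T\<close>. If
  \<open>U\<close> has no room for such a \<open>W\<close>, a factor of the product is 0.\<close>

lemma card_avoiding_between:
  fixes S T U :: "('a::{field,finite} ^ 'n::finite) set"
  assumes "vec.subspace S" "vec.subspace U" "S \<subseteq> U"
    and "vec.subspace T" "T \<subseteq> U" "T \<inter> S = {0}" "vec.dim T \<le> k"
  shows "real (card (avoiding_between k S T U)) =
    avoiding_number (real CARD('a)) k (vec.dim S) (vec.dim T) (vec.dim U)"
  using assms(4-7)
proof (induction "k - vec.dim T" arbitrary: T)
  case 0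
  have "W = T" if "W \<in> avoiding_between k S T U" for W
    using that 0 vec.subspace_dim_equal[of T W]
    by (auto simp: avoiding_between_def subspaces_of_dim_def)
  then have "avoiding_between k S T U = {T}"
    using 0 by (auto simp: avoiding_between_def subspaces_of_dim_def)
  then show ?case using 0 by (simp add: avoiding_number_def)
next
  case (Suc m)
  let ?q = "real CARD('a)" and ?i = "vec.dim T"
  let ?F = "avoiding_between k S T U"
  let ?ST = "{x + y |x y. x \<in> S \<and> y \<in> T}"
  let ?N = "avoiding_number ?q k (vec.dim S) (Suc ?i) (vec.dim U)"
  have lt: "?i < k" using Suc by simp
  \<comment> \<open>Since \<open>W\<close> meets \<open>S\<close> trivially, it meets
    \<open>S + T\<close> exactly in \<open>T\<close>.\<close>
  have fib1: "{v \<in> U - ?ST. v \<in> W} = W - T" if "W \<in> ?F" for W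
  proof -
    have W: "vec.subspace W" "T \<subseteq> W" "W \<subseteq> U" "W \<inter> S = {0}"
      using that by (auto simp: avoiding_between_def subspaces_of_dim_def)
    have "x + y \<in> T" if "x \<in> S" "y \<in> T" "x + y \<in> W" for x y
    proof -
      have "x \<in> W" using that W vec.subspace_diff[of W "x + y" y] by auto
      then have "x = 0" using that W by blast
      then show ?thesis using that by simp
    qed
    moreover have "v \<in> ?ST" if "v \<in> T" for v
      using that vec.subspace_0[OF assms(1)] by force
    ultimately show ?thesis using W by blast
  qed
  have fib2: "{W \<in> ?F. v \<in> W} = avoiding_between k S (vec.span (insert v T)) U" for v
    by (simp add: avoiding_between_def subspaces_of_dim_def span_insert_subset_iff conj_ac cong: conj_cong)
  have val: "real (card {W \<in> ?F. v \<in> W}) = ?N" if v: "v \<in> U - ?ST" for v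
  proof -
    have vT: "v \<notin> T" using v vec.subspace_0[OF assms(1)] by force
    have "x \<in> {0}" if x: "x \<in> vec.span (insert v T)" "x \<in> S" for x
    proof -
      obtain c where c: "x - c *s v \<in> T"
        using x(1) Suc.prems(1) by (auto simp: vec.span_insert vec.span_eq_iff[THEN iffD2])
      \<comment> \<open>A nonzero \<open>c\<close> would allow solving for \<open>v\<close> inside
        \<open>S + T\<close>.\<close>
      have "c = 0"
      proof (rule ccontr)
        assume "c \<noteq> 0"
        then have "v = inverse c *s x + - (inverse c *s (x - c *s v))"
          by (simp add: vec.scale_right_diff_distrib)
        moreover have "inverse c *s x \<in> S" "- (inverse c *s (x - c *s v)) \<in> T"
          using c x assms(1) Suc.prems(1)
          by (blast intro: vec.subspace_scale vec.subspace_neg)+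
        ultimately show False using v by blast
      qed
      then show ?thesis using c x Suc.prems by auto
    qed
    then have "vec.span (insert v T) \<inter> S = {0}"
      using assms(1) by (auto simp: vec.subspace_0 vec.span_zero)
    then show ?thesis
      using Suc.hyps(1)[of "vec.span (insert v T)"] Suc.hyps(2) Suc.prems assms(2) v lt
      by (simp add: fib2 dim_span_insert[OF Suc.prems(1) vT] span_insert_subset_iff del: vec.dim_span)
  qed
  have "(\<Sum>W\<in>?F. \<Sum>v\<in>{v \<in> U - ?ST. v \<in> W}. (1::real)) = (\<Sum>v\<in>U - ?ST. \<Sum>W\<in>{W \<in> ?F. v \<in> W}. 1)"
    by (rule sum.swap_restrict) auto
  then have "(\<Sum>W\<in>?F. real (card (W - T))) = (\<Sum>v\<in>U - ?ST. ?N)"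
    using fib1 val by simp
  moreover have "real (card (W - T)) = ?q ^ k - ?q ^ ?i" if "W \<in> ?F" for W
  proof -
    have W: "vec.subspace W" "T \<subseteq> W" "vec.dim W = k"
      using that by (auto simp: avoiding_between_def subspaces_of_dim_def)
    then have "real (card (W - T)) = real (card W) - real (card T)"
      by (simp add: card_Diff_subset card_mono of_nat_diff)
    then show ?thesis using W Suc.prems by (simp add: card_vec_subspace)
  qed
  moreover have "real (card (U - ?ST)) = ?q ^ vec.dim U - ?q ^ (vec.dim S + ?i)"
  proof -
    have sub: "?ST \<subseteq> U" using assms Suc.prems by (auto intro!: vec.subspace_add)
    then have "real (card (U - ?ST)) = real (card U) - real (card ?ST)"
      by (simp add: card_Diff_subset card_mono of_nat_diff)
    then show ?thesis using assms Suc.prems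
      by (simp add: card_vec_subspace card_set_plus_subspaces Int_commute)
  qed
  ultimately have "real (card ?F) * (?q ^ k - ?q ^ ?i) =
      (?q ^ vec.dim U - ?q ^ (vec.dim S + ?i)) * ?N" by simp
  moreover have "?q ^ ?i < ?q ^ k"
    using lt card_field_gt_1[where 'a='a] by simp
  ultimately show ?case
    using lt by (simp add: avoiding_number_def prod.atLeast_Suc_lessThan field_simps)
qed

lemma avoiding_number_pos:
  assumes "1 < q" "s + k \<le> u"
  shows "0 < avoiding_number q k s i u"
  unfolding avoiding_number_def
proof (intro prod_pos ballI divide_pos_pos)
  fix j assume "j \<in> {i..<k}"
  then have "s + j < u" "j < k" using assms by auto
  then show "0 < q ^ u - q ^ (s + j)" "0 < q ^ k - q ^ j"
    using assms by (auto intro: power_strict_increasing)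
qed

lemma avoiding_number_step:
  assumes "i < k"
  shows "avoiding_number q k s i u =
    (q ^ u - q ^ (s + i)) / (q ^ k - q ^ i) * avoiding_number q k s (Suc i) u"
  using assms by (simp add: avoiding_number_def prod.atLeast_Suc_lessThan)

section \<open>Spectrum of the \<open>q\<close>-Kneser graph\<close>

text \<open>Coordinates range over all sets of vectors, a finite type, with zeros off the
  \<open>r\<close>-subspaces. This gives access to the inner product and the spans of
  \<open>real ^ _\<close>.\<close>

definition inclusion_vec ::
  "nat \<Rightarrow> ('a::{field,finite} ^ 'n::finite) set \<Rightarrow> real ^ (('a ^ 'n) set)" where
  "inclusion_vec r T = (\<chi> S. if S \<in> subspaces_of_dim r \<and> T \<subseteq> S then 1 else 0)"

definition disjointness_vec ::
  "nat \<Rightarrow> ('a::{field,finite} ^ 'n::finite) set \<Rightarrow> real ^ (('a ^ 'n) set)" where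
  "disjointness_vec r T = (\<chi> S. if S \<in> subspaces_of_dim r \<and> T \<inter> S = {0} then 1 else 0)"

definition inclusion_space ::
  "nat \<Rightarrow> nat \<Rightarrow> (real ^ (('a::{field,finite} ^ 'n::finite) set)) set" where
  "inclusion_space r j = span {inclusion_vec r T |T. vec.subspace T \<and> vec.dim T \<le> j}"

definition qkneser_op ::
  "nat \<Rightarrow> real ^ (('a::{field,finite} ^ 'n::finite) set) \<Rightarrow> real ^ (('a ^ 'n) set)" where
  "qkneser_op r x = (\<chi> S. if S \<in> subspaces_of_dim r
     then (\<Sum>S' | S' \<in> subspaces_of_dim r \<and> S \<inter> S' = {0}. x $ S') else 0)"

text \<open>The classical eigenvalues of the \<open>q\<close>-Kneser graph. The exponent
  \<open>\<Sum>{..<j}\<close> is \<open>j (j - 1) / 2\<close>, and the last factor counts the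
  \<open>r\<close>-subspaces through a \<open>j\<close>-subspace that avoid an
  \<open>r\<close>-subspace disjoint from it.\<close>

definition qkneser_eigenvalue :: "real \<Rightarrow> nat \<Rightarrow> nat \<Rightarrow> nat \<Rightarrow> real" where
  "qkneser_eigenvalue q n r j = (- 1) ^ j * q ^ (\<Sum>{..<j}) * avoiding_number q r r j n"

lemma subspace_inclusion_space [simp]: "subspace (inclusion_space r j)"
  by (simp add: inclusion_space_def)

lemma inclusion_vec_in_space:
  "vec.subspace T \<Longrightarrow> vec.dim T \<le> j \<Longrightarrow> inclusion_vec r T \<in> inclusion_space r j"
  unfolding inclusion_space_def by (intro span_base) auto

lemma inclusion_space_mono: "i \<le> j \<Longrightarrow> inclusion_space r i \<subseteq> inclusion_space r j"
  unfolding inclusion_space_def by (intro span_mono) auto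

lemma linear_qkneser_op: "linear (qkneser_op r)"
  by (rule linearI)
    (auto simp: qkneser_op_def vec_eq_iff sum.distrib sum_distrib_left)

lemma qkneser_op_self_adjoint: "qkneser_op r x \<bullet> y = x \<bullet> qkneser_op r y"
proof -
  let ?V = "subspaces_of_dim r"
  have "qkneser_op r x \<bullet> y =
      (\<Sum>S\<in>?V. (\<Sum>S' | S' \<in> ?V \<and> S \<inter> S' = {0}. x $ S') * y $ S)"
    unfolding inner_vec_def qkneser_op_def
    by (intro sum.mono_neutral_cong_right) auto
  also have "\<dots> = (\<Sum>S\<in>?V. \<Sum>S' | S' \<in> ?V \<and> S \<inter> S' = {0}. x $ S' * y $ S)"
    by (simp add: sum_distrib_right)
  also have "\<dots> = (\<Sum>S'\<in>?V. \<Sum>S | S \<in> ?V \<and> S \<inter> S' = {0}. x $ S' * y $ S)"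
    by (rule sum.swap_restrict) auto
  also have "\<dots> = (\<Sum>S'\<in>?V. x $ S' * (\<Sum>S | S \<in> ?V \<and> S' \<inter> S = {0}. y $ S))"
    by (simp add: sum_distrib_left Int_commute)
  also have "\<dots> = x \<bullet> qkneser_op r y"
    unfolding inner_vec_def qkneser_op_def
    by (intro sum.mono_neutral_cong_left) auto
  finally show ?thesis .
qed

section \<open>Action of the adjacency operator on the inclusion spaces\<close>

text \<open>The entry at \<open>S\<close> counts the \<open>r\<close>-subspaces through
  \<open>T\<close> that avoid \<open>S\<close>. There are none if \<open>T\<close> meets
  \<open>S\<close> nontrivially, and otherwise their number depends on dimensions only.\<close>

lemma qkneser_op_inclusion_vec:
  fixes T :: "('a::{field,finite} ^ 'n::finite) set"
  assumes T: "vec.subspace T" "vec.dim T \<le> r"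
  shows "qkneser_op r (inclusion_vec r T) =
    avoiding_number (real CARD('a)) r r (vec.dim T) CARD('n) *\<^sub>R disjointness_vec r T"
proof -
  have "(\<Sum>S' | S' \<in> subspaces_of_dim r \<and> S \<inter> S' = {0}. inclusion_vec r T $ S') =
      avoiding_number (real CARD('a)) r r (vec.dim T) CARD('n) * (if T \<inter> S = {0} then 1 else 0)"
    if S: "S \<in> subspaces_of_dim r" for S :: "('a ^ 'n) set"
  proof -
    have "(\<Sum>S' | S' \<in> subspaces_of_dim r \<and> S \<inter> S' = {0}. inclusion_vec r T $ S') =
        (\<Sum>S'\<in>avoiding_between r S T UNIV. 1)"
      by (rule sum.mono_neutral_cong_right) (auto simp: inclusion_vec_def avoiding_between_def)
    also have "\<dots> = avoiding_number (real CARD('a)) r r (vec.dim T) CARD('n) *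
        (if T \<inter> S = {0} then 1 else 0)"
    proof (cases "T \<inter> S = {0}")
      case True
      then show ?thesis
        using card_avoiding_between[of S UNIV T r, unfolded vec_dim_card] S T
        by (simp add: subspaces_of_dim_def)
    next
      case False
      then have "avoiding_between r S T UNIV = {}"
        using S T vec.subspace_0 by (fastforce simp: avoiding_between_def subspaces_of_dim_def)
      then show ?thesis using False by simp
    qed
    finally show ?thesis .
  qed
  then show ?thesis
    by (simp add: vec_eq_iff qkneser_op_def disjointness_vec_def)
qed

text \<open>Since \<open>\<bar>T \<inter> S\<bar> = \<Sum>\<^bsub>v \<in> T\<^esub> [v \<in> S]\<close>, multiplying by it adds a vector to each generator.\<close>

lemma card_Int_mult_in_inclusion_space:
  fixes T :: "('a::{field,finite} ^ 'n::finite) set"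
  assumes "x \<in> inclusion_space r i"
  shows "(\<chi> S. (real (card (T \<inter> S)) - c) * x $ S) \<in> inclusion_space r (Suc i)"
proof -
  let ?f = "\<lambda>x :: real ^ (('a ^ 'n) set). (\<chi> S. real (card (T \<inter> S)) * x $ S)"
  have "linear ?f" by (rule linearI) (auto simp: vec_eq_iff algebra_simps)
  have gen: "?f (inclusion_vec r T') \<in> inclusion_space r (Suc i)"
    if T': "vec.subspace T'" "vec.dim T' \<le> i" for T'
  proof -
    have "real (card (T \<inter> S)) * inclusion_vec r T' $ S =
        (\<Sum>v\<in>T. inclusion_vec r (vec.span (insert v T')) $ S)" for S
    proof (cases "S \<in> subspaces_of_dim r \<and> T' \<subseteq> S")
      case True
      then show ?thesis
        by (simp add: inclusion_vec_def span_insert_subset_iff subspaces_of_dim_def sum.If_cases Int_def)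
    next
      case False
      then show ?thesis
        by (auto simp: inclusion_vec_def span_insert_subset_iff subspaces_of_dim_def
            cong: conj_cong)
    qed
    then have "?f (inclusion_vec r T') = (\<Sum>v\<in>T. inclusion_vec r (vec.span (insert v T')))"
      by (simp add: vec_eq_iff)
    also have "\<dots> \<in> inclusion_space r (Suc i)"
      using T' by (intro subspace_sum inclusion_vec_in_space) (auto simp: vec.dim_insert)
    finally show ?thesis .
  qed
  have "?f x \<in> inclusion_space r (Suc i)"
    using assms unfolding inclusion_space_def
  proof (induction rule: span_induct_alt)
    case base
    have "?f 0 = 0" by (simp add: vec_eq_iff)
    then show ?case by (simp only: span_zero)
  next
    case (step c y z)
    then have "?f y \<in> inclusion_space r (Suc i)" using gen by blast
    then show ?case
      unfolding linear_add[OF \<open>linear ?f\<close>] linear_scale[OF \<open>linear ?f\<close>]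
      using step.IH by (simp add: span_add span_mul inclusion_space_def)
  qed
  moreover have "x \<in> inclusion_space r (Suc i)"
    using assms inclusion_space_mono[of i "Suc i" r] by auto
  ultimately have "?f x - c *\<^sub>R x \<in> inclusion_space r (Suc i)"
    by (intro subspace_diff subspace_scale) auto
  moreover have "?f x - c *\<^sub>R x = (\<chi> S. (real (card (T \<inter> S)) - c) * x $ S)"
    by (simp add: vec_eq_iff left_diff_distrib)
  ultimately show ?thesis by simp
qed

text \<open>The empty product is the constant 1, which is the inclusion vector of
  \<open>{0}\<close>, and each further factor raises the level by one.\<close>

lemma prod_card_Int_in_inclusion_space:
  fixes T :: "('a::{field,finite} ^ 'n::finite) set" and c :: "nat \<Rightarrow> real"
  shows "(\<chi> S. if S \<in> subspaces_of_dim r then \<Prod>k\<in>{1..i}. (real (card (T \<inter> S)) - c k) else 0)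
    \<in> inclusion_space r i"
proof (induction i)
  case 0
  have "inclusion_vec r {0 :: 'a ^ 'n} \<in> inclusion_space r 0"
    by (rule inclusion_vec_in_space) auto
  moreover have "inclusion_vec r {0} = (\<chi> S :: ('a ^ 'n) set. if S \<in> subspaces_of_dim r then 1 else 0)"
    by (auto simp: inclusion_vec_def vec_eq_iff subspaces_of_dim_def vec.subspace_0)
  ultimately show ?case by (simp cong: if_cong)
next
  case (Suc i)
  from card_Int_mult_in_inclusion_space[OF this, of T "c (Suc i)"]
  show ?case by (simp add: if_distrib mult.commute cong: if_cong)
qed

text \<open>Relates the value of \<open>(m - 1) ... (m - q^(j-1))\<close> at \<open>m = q^j\<close>
  to the value of \<open>(m - q) ... (m - q^j)\<close> at \<open>m = 1\<close>; their ratio is the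
  sign and power of \<open>q\<close> in \<open>qkneser_eigenvalue\<close>.\<close>

lemma prod_power_diff:
  fixes q :: real
  shows "(\<Prod>k<j. q ^ j - q ^ k) = (- 1) ^ j * q ^ (\<Sum>{..<j}) * (\<Prod>k\<in>{1..j}. 1 - q ^ k)"
proof -
  have "(\<Prod>k<j. q ^ j - q ^ k) = (\<Prod>k<j. (- 1) * (q ^ k * (1 - q ^ (j - k))))"
    by (rule prod.cong) (auto simp: right_diff_distrib simp flip: power_add)
  also have "\<dots> = (- 1) ^ j * (q ^ (\<Sum>{..<j}) * (\<Prod>k<j. 1 - q ^ (j - k)))"
    by (simp only: prod.distrib power_sum prod_constant card_lessThan)
  also have "(\<Prod>k<j. 1 - q ^ (j - k)) = (\<Prod>k\<in>{1..j}. 1 - q ^ k)"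
    by (rule prod.reindex_bij_witness[of _ "\<lambda>k. j - k" "\<lambda>k. j - k"]) auto
  finally show ?thesis by (simp add: mult.assoc)
qed

text \<open>
  With \<open>m = \<bar>T \<inter> S\<bar>\<close>, the polynomial \<open>(m - q) \<cdots> (m - q\<^sup>j)\<close> detects \<open>T \<inter> S = {0}\<close> and
  \<open>(m - 1) \<cdots> (m - q\<^bsup>j-1\<^esup>)\<close> detects \<open>T \<subseteq> S\<close>; their difference has degree \<open>j - 1\<close>.
\<close>

lemma disjointness_vec_approx:
  fixes T :: "('a::{field,finite} ^ 'n::finite) set"
  assumes T: "vec.subspace T" "vec.dim T = j"
  defines "q \<equiv> real CARD('a)"
  shows "disjointness_vec r T - ((- 1) ^ j * q ^ (\<Sum>{..<j})) *\<^sub>R inclusion_vec r T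
    \<in> inclusion_space r (j - 1)"
proof (cases "j = 0")
  \<comment> \<open>Here \<open>j - 1\<close> is again 0, but the two vectors coincide and the
    coefficient is 1, so the difference is 0.\<close>
  case True
  then have "T = {0}" using T vec.subspace_0 by (auto simp: vec.dim_eq_0)
  then have "disjointness_vec r T = inclusion_vec r T"
    by (auto simp: disjointness_vec_def inclusion_vec_def vec_eq_iff subspaces_of_dim_def vec.subspace_0)
  then show ?thesis using True by (simp add: subspace_0)
next
  case False
  then obtain i where i: "j = Suc i" by (cases j) auto
  have q: "1 < q" using card_field_gt_1[where 'a='a] by (simp add: q_def)
  \<comment> \<open>\<open>D\<close> is the value at \<open>m = 1\<close> of the polynomial
    detecting \<open>T \<inter> S = {0}\<close>, and \<open>g\<close> is the common factor of the
    two polynomials. Their difference is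
    \<open>((m - q^j) - (m - 1)) g = (1 - q^j) g\<close>.\<close>
  define D where "D = (\<Prod>k\<in>{1..j}. 1 - q ^ k)"
  define g :: "real ^ (('a ^ 'n) set)" where
    "g = (\<chi> S. if S \<in> subspaces_of_dim r then \<Prod>k\<in>{1..i}. (real (card (T \<inter> S)) - q ^ k) else 0)"
  have "q ^ k \<noteq> 1" if "1 \<le> k" for k
    using one_less_power[OF q, of k] that by simp
  then have "D \<noteq> 0" by (simp add: D_def)
  have g: "g \<in> inclusion_space r i"
    unfolding g_def by (rule prod_card_Int_in_inclusion_space)
  have "D * (disjointness_vec r T $ S - (- 1) ^ j * q ^ (\<Sum>{..<j}) * inclusion_vec r T $ S) =
      (1 - q ^ j) * g $ S" for S
  proof (cases "S \<in> subspaces_of_dim r")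
    case True
    define m where "m = real (card (T \<inter> S))"
    define d where "d = vec.dim (T \<inter> S)"
    have S: "vec.subspace (T \<inter> S)"
      using True T by (auto simp: subspaces_of_dim_def intro: vec.subspace_inter)
    then have m: "m = q ^ d" by (simp add: m_def d_def q_def card_vec_subspace)
    have "d \<le> j" unfolding d_def T(2)[symmetric] by (rule vec.dim_subset) auto
    have d0: "d = 0 \<longleftrightarrow> T \<inter> S = {0}"
      using S vec.subspace_0[OF S] by (auto simp: d_def vec.dim_eq_0)
    have dj: "d = j \<longleftrightarrow> T \<subseteq> S"
      using vec.subspace_dim_equal[of "T \<inter> S" T] S T by (auto simp: d_def Int_absorb2)
    have "(\<Prod>k\<in>{1..j}. m - q ^ k) = D * disjointness_vec r T $ S"
    proof (cases "d = 0")
      case False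
      then have "(\<Prod>k\<in>{1..j}. m - q ^ k) = 0"
        using \<open>d \<le> j\<close> by (intro prod_zero bexI[of _ d]) (auto simp: m)
      then show ?thesis using False d0 by (simp add: disjointness_vec_def)
    qed (use True d0 in \<open>simp add: D_def m disjointness_vec_def\<close>)
    moreover have "(\<Prod>k<j. m - q ^ k) = D * ((- 1) ^ j * q ^ (\<Sum>{..<j}) * inclusion_vec r T $ S)"
    proof (cases "d = j")
      case False
      then have "(\<Prod>k<j. m - q ^ k) = 0"
        using \<open>d \<le> j\<close> by (intro prod_zero bexI[of _ d]) (auto simp: m)
      then show ?thesis using False dj by (simp add: inclusion_vec_def)
    qed (use True dj in \<open>simp add: prod_power_diff D_def m inclusion_vec_def\<close>)
    moreover have "(\<Prod>k\<in>{1..j}. m - q ^ k) = g $ S * (m - q ^ j)"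
      using True by (simp add: g_def m_def i)
    moreover have "(\<Prod>k<j. m - q ^ k) = (m - 1) * g $ S"
      unfolding i using True
      by (simp add: g_def m_def prod.lessThan_Suc_shift prod.atLeast1_atMost_eq del: prod.lessThan_Suc)
    ultimately show ?thesis by (simp add: algebra_simps)
  next
    case False
    then show ?thesis by (simp add: g_def disjointness_vec_def inclusion_vec_def)
  qed
  then have "disjointness_vec r T - ((- 1) ^ j * q ^ (\<Sum>{..<j})) *\<^sub>R inclusion_vec r T =
      ((1 - q ^ j) / D) *\<^sub>R g"
    using \<open>D \<noteq> 0\<close> by (simp add: vec_eq_iff field_simps)
  then show ?thesis using g by (simp add: i subspace_scale)
qed

text \<open>By linearity it suffices to treat a generator with subspace \<open>T\<close>. Replacing
  its disjointness vector by a multiple of its inclusion vector costs only a lower-level term; the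
  remaining coefficient is 0 if \<open>vec.dim T = j\<close>, and otherwise the generator itself has
  lower level. For \<open>j = 0\<close> the claim is just invariance of level 0.\<close>

lemma qkneser_op_inclusion_space:
  fixes x :: "real ^ (('a::{field,finite} ^ 'n::finite) set)"
  assumes x: "x \<in> inclusion_space r j" and j: "j \<le> r"
  shows "qkneser_op r x - qkneser_eigenvalue (real CARD('a)) CARD('n) r j *\<^sub>R x
    \<in> inclusion_space r (j - 1)"
proof -
  let ?q = "real CARD('a)"
  let ?ev = "qkneser_eigenvalue ?q CARD('n) r j"
  let ?f = "\<lambda>x :: real ^ (('a ^ 'n) set). qkneser_op r x - ?ev *\<^sub>R x"
  have lin: "linear ?f"
    by (intro linear_compose_sub linear_qkneser_op linear_scale_self)
  have gen: "?f (inclusion_vec r T) \<in> inclusion_space r (j - 1)"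
    if T: "vec.subspace T" "vec.dim T \<le> j" for T
  proof -
    let ?N = "avoiding_number ?q r r (vec.dim T) CARD('n)"
    let ?a = "(- 1) ^ vec.dim T * ?q ^ (\<Sum>{..<vec.dim T})"
    define z where "z = disjointness_vec r T - ?a *\<^sub>R inclusion_vec r T"
    have z: "z \<in> inclusion_space r (vec.dim T - 1)"
      unfolding z_def by (rule disjointness_vec_approx) (use T in auto)
    then have "z \<in> inclusion_space r (j - 1)"
      using inclusion_space_mono[OF diff_le_mono[OF T(2)]] by blast
    moreover have eq: "?f (inclusion_vec r T) = ?N *\<^sub>R z + (?N * ?a - ?ev) *\<^sub>R inclusion_vec r T"
      using T j by (simp add: qkneser_op_inclusion_vec z_def algebra_simps)
    moreover have "(?N * ?a - ?ev) *\<^sub>R inclusion_vec r T \<in> inclusion_space r (j - 1)"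
    proof (cases "vec.dim T = j")
      case True
      then show ?thesis by (simp add: qkneser_eigenvalue_def subspace_0)
    next
      case False
      then show ?thesis using T j
        by (intro subspace_scale inclusion_vec_in_space) auto
    qed
    ultimately show ?thesis by (simp add: subspace_add subspace_scale)
  qed
  show ?thesis
    using x unfolding inclusion_space_def[of r j]
  proof (induction rule: span_induct_alt)
    case base
    then show ?case using linear_0[OF lin] subspace_0[OF subspace_inclusion_space] by metis
  next
    case (step c y z)
    then have "?f y \<in> inclusion_space r (j - 1)" using gen by blast
    then have "c *\<^sub>R ?f y + ?f z \<in> inclusion_space r (j - 1)"
      using step.IH by (intro subspace_add subspace_scale) auto
    then show ?case using linear_add[OF lin, of "c *\<^sub>R y" z] linear_scale[OF lin, of c y] by metis
  qed
qed

section \<open>Positivity of the shifted adjacency form\<close>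

text \<open>The absolute values \<open>b i\<close> of the eigenvalues decrease strictly from
  \<open>i = 1\<close> on, and \<open>b 1\<close> is the right-hand side. The quotient of
  \<open>b i\<close> by \<open>b (Suc i)\<close> is
  \<open>(q^n - q^(r+i)) / ((q^r - q^i) q^i)\<close>.\<close>

lemma qkneser_eigenvalue_strict_bound:
  fixes q :: real
  assumes q: "2 \<le> q" and n: "2 * r \<le> n" and j: "2 \<le> j" "j \<le> r"
  shows "\<bar>qkneser_eigenvalue q n r j\<bar> < avoiding_number q r r 1 n"
proof -
  define b where "b j = q ^ (\<Sum>{..<j}) * avoiding_number q r r j n" for j
  have pos: "0 < b j" for j
    using q n by (simp add: b_def avoiding_number_pos)
  have step: "b (Suc i) < b i" if i: "1 \<le> i" "i < r" for i
  proof -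
    \<comment> \<open>From \<open>i < r\<close> and \<open>2 * r \<le> n\<close> follows
      \<open>r + i < n\<close>, so \<open>q \<ge> 2\<close> makes \<open>q^n\<close> at least twice
      \<open>q^(r+i)\<close>.\<close>
    have "q ^ i * (q ^ r - q ^ i) < q ^ n - q ^ (r + i)"
    proof -
      have "q ^ i * (q ^ r - q ^ i) < q ^ (r + i)"
        using q by (simp add: right_diff_distrib power_add mult.commute)
      also have "2 * q ^ (r + i) \<le> q ^ Suc (r + i)" using q by simp
      then have "2 * q ^ (r + i) \<le> q ^ n"
        using power_increasing[of "Suc (r + i)" n q] q n i by linarith
      then have "q ^ (r + i) \<le> q ^ n - q ^ (r + i)" by simp
      finally show ?thesis .
    qed
    moreover have "0 < q ^ r - q ^ i" using q i by (simp add: power_strict_increasing)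
    ultimately have "q ^ i < (q ^ n - q ^ (r + i)) / (q ^ r - q ^ i)"
      by (simp add: pos_less_divide_eq)
    moreover have "0 < q ^ (\<Sum>{..<i}) * avoiding_number q r r (Suc i) n"
      using q n by (simp add: avoiding_number_pos)
    ultimately have "q ^ (\<Sum>{..<i}) * avoiding_number q r r (Suc i) n * q ^ i <
        q ^ (\<Sum>{..<i}) * avoiding_number q r r (Suc i) n * ((q ^ n - q ^ (r + i)) / (q ^ r - q ^ i))"
      by (rule mult_strict_left_mono)
    then show ?thesis
      unfolding b_def avoiding_number_step[OF i(2)] by (simp add: power_add ac_simps)
  qed
  have "b j < b 1" using j
  proof (induction j rule: dec_induct)
    case base
    then show ?case using step[of 1] j by (simp add: numeral_2_eq_2)
  next
    case (step i)
    then show ?case using \<open>\<And>i. 1 \<le> i \<Longrightarrow> i < r \<Longrightarrow> b (Suc i) < b i\<close>[of i] by simp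
  qed
  then show ?thesis
    using pos[of j] avoiding_number_pos[of q r r n j] q n
    by (simp add: qkneser_eigenvalue_def b_def abs_mult power_abs)
qed

text \<open>The added constant is minus the eigenvalue at \<open>j = 1\<close>.\<close>

definition qkneser_form ::
  "nat \<Rightarrow> real ^ (('a::{field,finite} ^ 'n::finite) set) \<Rightarrow> real" where
  "qkneser_form r x =
     qkneser_op r x \<bullet> x + avoiding_number (real CARD('a)) r r 1 CARD('n) * (x \<bullet> x)"

text \<open>Induction on the level, splitting \<open>x = u + v\<close> with \<open>u\<close> one
  level lower and \<open>v\<close> orthogonal to that level. The operator preserves the lower level
  and acts on \<open>v\<close> as a scalar modulo it, so self-adjointness kills the cross terms and
  \<open>v\<close> contributes \<open>(?ev + ?c) * (v \<bullet> v)\<close>.\<close>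

lemma qkneser_form_inclusion_space:
  fixes x :: "real ^ (('a::{field,finite} ^ 'n::finite) set)"
  assumes n: "2 * r \<le> CARD('n)" and x: "x \<in> inclusion_space r j" and "j \<le> r"
  shows "0 \<le> qkneser_form r x \<and> (qkneser_form r x = 0 \<longrightarrow> x \<in> inclusion_space r 1)"
  using x \<open>j \<le> r\<close>
proof (induction j arbitrary: x)
  \<comment> \<open>Level 0 consists of the multiples of the constant function, an eigenvector whose
    eigenvalue is the positive vertex degree.\<close>
  case 0
  let ?q = "real CARD('a)"
  have q: "1 < ?q" using card_field_gt_1[where 'a='a] by simp
  have pos: "0 < avoiding_number ?q r r i CARD('n)" for i
    by (rule avoiding_number_pos) (use q n in auto)
  have "vec.subspace T \<and> vec.dim T \<le> 0 \<longleftrightarrow> T = {0}" for T :: "('a ^ 'n) set"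
    by (auto simp: vec.dim_eq_0 dest: vec.subspace_0)
  then obtain k where k: "x = k *\<^sub>R inclusion_vec r {0}"
    using 0 by (auto simp: inclusion_space_def span_singleton)
  have "disjointness_vec r {0} = inclusion_vec r {0 :: 'a ^ 'n}"
    by (auto simp: disjointness_vec_def inclusion_vec_def vec_eq_iff subspaces_of_dim_def vec.subspace_0)
  then have "qkneser_op r x = avoiding_number ?q r r 0 CARD('n) *\<^sub>R x"
    unfolding k linear_scale[OF linear_qkneser_op] by (subst qkneser_op_inclusion_vec) auto
  then have "0 \<le> qkneser_form r x"
    using pos[of 0] pos[of 1] by (simp add: qkneser_form_def)
  then show ?case using 0 inclusion_space_mono[of 0 1 r] by auto
next
  case (Suc j)
  let ?q = "real CARD('a)"
  let ?ev = "qkneser_eigenvalue ?q CARD('n) r (Suc j)"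
  let ?c = "avoiding_number ?q r r 1 CARD('n)"
  obtain u v where u: "u \<in> inclusion_space r j" and x: "x = u + v"
    and orth: "\<And>w. w \<in> inclusion_space r j \<Longrightarrow> v \<bullet> w = 0"
    using orthogonal_subspace_decomp_exists[of "inclusion_space r j" x]
    by (metis orthogonal_def span_eq_iff subspace_inclusion_space)
  have "v \<in> inclusion_space r (Suc j)"
    using subspace_diff[OF subspace_inclusion_space Suc.prems(1), of u] u
      inclusion_space_mono[of j "Suc j" r] x by auto
  then have diff: "qkneser_op r v - ?ev *\<^sub>R v \<in> inclusion_space r j"
    using qkneser_op_inclusion_space[of v r "Suc j"] Suc.prems by simp
  have "(qkneser_op r v - ?ev *\<^sub>R v) \<bullet> v = 0"
    using orth[OF diff] by (simp add: inner_commute)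
  then have vv: "qkneser_op r v \<bullet> v = ?ev * (v \<bullet> v)"
    by (simp add: inner_diff_left)
  have "qkneser_op r u - qkneser_eigenvalue ?q CARD('n) r j *\<^sub>R u \<in> inclusion_space r j"
    using qkneser_op_inclusion_space[OF u] Suc.prems(2) inclusion_space_mono[of "j - 1" j r] by auto
  from subspace_add[OF subspace_inclusion_space this
      subspace_scale[OF subspace_inclusion_space u, of "qkneser_eigenvalue ?q CARD('n) r j"]]
  have "qkneser_op r u \<in> inclusion_space r j" by simp
  then have "v \<bullet> qkneser_op r u = 0" and vu: "v \<bullet> u = 0" using orth u by auto
  then have uv: "qkneser_op r u \<bullet> v = 0" "qkneser_op r v \<bullet> u = 0" "u \<bullet> v = 0"
    using qkneser_op_self_adjoint[of r v u] by (simp_all add: inner_commute)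
  have form: "qkneser_form r x = qkneser_form r u + (?ev + ?c) * (v \<bullet> v)"
    unfolding qkneser_form_def x linear_add[OF linear_qkneser_op]
    by (simp add: inner_add_left inner_add_right uv vu vv algebra_simps)
  have IH: "0 \<le> qkneser_form r u" "qkneser_form r u = 0 \<Longrightarrow> u \<in> inclusion_space r 1"
    using Suc.IH[OF u] Suc.prems(2) by auto
  show ?case
  proof (cases "j = 0")
    \<comment> \<open>At level 1 the contribution of \<open>v\<close> is 0 whatever \<open>v\<close>
      is, but then \<open>x\<close> lies in the claimed space by assumption.\<close>
    case True
    then have "?ev + ?c = 0" by (simp add: qkneser_eigenvalue_def)
    then show ?thesis using form IH Suc.prems(1) True by simp
  next
    case False
    then have "\<bar>?ev\<bar> < ?c"
      using card_field_gt_1[where 'a='a] n Suc.prems(2)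
      by (intro qkneser_eigenvalue_strict_bound) auto
    then have "0 < ?ev + ?c" by linarith
    then have vv0: "0 \<le> (?ev + ?c) * (v \<bullet> v)" "(?ev + ?c) * (v \<bullet> v) = 0 \<Longrightarrow> x = u"
      using x by auto
    have "x \<in> inclusion_space r 1" if "qkneser_form r x = 0"
    proof -
      have "qkneser_form r u = 0" "(?ev + ?c) * (v \<bullet> v) = 0"
        using that form IH(1) vv0(1) by linarith+
      then show ?thesis using IH(2) vv0(2) by simp
    qed
    then show ?thesis using form IH(1) vv0(1) by simp
  qed
qed

section \<open>Functions of lines\<close>

definition lines_in :: "('a::{field,finite} ^ 'n::finite) set \<Rightarrow> ('a ^ 'n) set set" where
  "lines_in S = {L \<in> subspaces_of_dim 1. L \<subseteq> S}"

lemma card_lines_in: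
  fixes S :: "('a::{field,finite} ^ 'n::finite) set"
  assumes "vec.subspace S"
  shows "real (card (lines_in S)) = q_number CARD('a) (vec.dim S)"
proof -
  have "lines_in S = avoiding_between 1 {0} {0} S"
    by (auto simp: lines_in_def avoiding_between_def subspaces_of_dim_def vec.subspace_0)
  then show ?thesis
    using card_avoiding_between[of "{0}" S "{0}" 1] assms
    by (simp add: avoiding_number_def q_number_def vec.subspace_0)
qed

lemma line_eq_span:
  fixes L :: "('a::{field,finite} ^ 'n::finite) set"
  assumes "L \<in> subspaces_of_dim 1" "b \<in> L" "b \<noteq> 0"
  shows "L = vec.span {b}"
  using vec.subspace_dim_equal[of "vec.span {b}" L] assms
  by (simp add: subspaces_of_dim_def vec.span_minimal)

lemma line_exists_generator:
  fixes L :: "('a::{field,finite} ^ 'n::finite) set"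
  assumes "L \<in> subspaces_of_dim 1"
  obtains b where "b \<noteq> 0" "b \<in> L" "L = vec.span {b}"
proof -
  have "\<not> L \<subseteq> {0}"
    using assms vec.dim_eq_0[of L] by (simp add: subspaces_of_dim_def)
  then show ?thesis using that line_eq_span[OF assms] by blast
qed

lemma line_Int_subspace:
  fixes L S :: "('a::{field,finite} ^ 'n::finite) set"
  assumes "L \<in> subspaces_of_dim 1" "vec.subspace S" "\<not> L \<subseteq> S"
  shows "L \<inter> S = {0}"
proof -
  have "b = 0" if "b \<in> L" "b \<in> S" for b
    using line_eq_span[OF assms(1) that(1)] that(2) assms(2,3) vec.span_minimal[of "{b}" S] by auto
  then show ?thesis
    using assms by (auto simp: subspaces_of_dim_def vec.subspace_0)
qed

text \<open>The inclusion vector of an \<open>r\<close>-subspace is a unit vector, because an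
  \<open>r\<close>-subspace contains no other \<open>r\<close>-subspace.\<close>

lemma inclusion_space_top:
  fixes x :: "real ^ (('a::{field,finite} ^ 'n::finite) set)"
  assumes "\<And>S. S \<notin> subspaces_of_dim r \<Longrightarrow> x $ S = 0"
  shows "x \<in> inclusion_space r r"
proof -
  have "inclusion_vec r S $ S' = (if S = S' then 1 else 0)"
    if "S \<in> subspaces_of_dim r" for S S' :: "('a ^ 'n) set"
    using that vec.subspace_dim_equal[of S S']
    by (auto simp: inclusion_vec_def subspaces_of_dim_def)
  then have "(\<Sum>S\<in>subspaces_of_dim r. x $ S * inclusion_vec r S $ S') =
      (\<Sum>S\<in>subspaces_of_dim r. if S = S' then x $ S else 0)" for S'
    by (intro sum.cong) auto
  then have "x = (\<Sum>S\<in>subspaces_of_dim r. x $ S *\<^sub>R inclusion_vec r S)"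
    using assms by (simp add: vec_eq_iff)
  also have "\<dots> \<in> inclusion_space r r"
    by (intro subspace_sum subspace_scale inclusion_vec_in_space)
      (auto simp: subspaces_of_dim_def)
  finally show ?thesis .
qed

text \<open>A generator for a line is the sum of point weights concentrated at that line. The
  constant generator is obtained by giving every line the weight \<open>1 / ?m\<close>, since each
  \<open>r\<close>-subspace has \<open>?m\<close> lines.\<close>

lemma inclusion_space_1_lines:
  fixes x :: "real ^ (('a::{field,finite} ^ 'n::finite) set)"
  assumes "x \<in> inclusion_space r 1" "1 \<le> r"
  shows "\<exists>y. \<forall>S\<in>subspaces_of_dim r. x $ S = (\<Sum>L\<in>lines_in S. y L)"
  using assms(1) unfolding inclusion_space_def
proof (induction rule: span_induct_alt)
  case base
  show ?case by (rule exI[of _ "\<lambda>_. 0"]) simp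
next
  case (step c w z)
  then obtain y where y: "\<forall>S\<in>subspaces_of_dim r. z $ S = (\<Sum>L\<in>lines_in S. y L)" by blast
  obtain T where T: "vec.subspace T" "vec.dim T \<le> 1" "w = inclusion_vec r T"
    using step by blast
  let ?m = "q_number CARD('a) r"
  have "1 < real CARD('a)" using card_field_gt_1[where 'a='a] by simp
  then have "0 < ?m"
    using assms(2) one_less_power[of "real CARD('a)" r] by (simp add: q_number_def)
  define t where "t L = (if vec.dim T = 0 then 1 / ?m else if L = T then 1 else 0)" for L
  have "w $ S = (\<Sum>L\<in>lines_in S. t L)" if S: "S \<in> subspaces_of_dim r" for S
  proof (cases "vec.dim T = 0")
    case True
    then have "T \<subseteq> S" using S by (auto simp: vec.dim_eq_0 subspaces_of_dim_def vec.subspace_0)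
    then show ?thesis
      using True S \<open>0 < ?m\<close> card_lines_in[of S]
      by (simp add: T(3) inclusion_vec_def t_def subspaces_of_dim_def)
  next
    case False
    then have "T \<in> subspaces_of_dim 1" using T(1,2) by (simp add: subspaces_of_dim_def del: vec.dim_eq_0)
    then show ?thesis using False S by (simp add: T(3) inclusion_vec_def t_def lines_in_def)
  qed
  then have "\<forall>S\<in>subspaces_of_dim r. (c *\<^sub>R w + z) $ S = (\<Sum>L\<in>lines_in S. c * t L + y L)"
    using y by (simp add: sum.distrib sum_distrib_left)
  then show ?case by blast
qed

text \<open>Fewer hyperplanes of \<open>U\<close> contain two given lines than one, which makes the incidence map injective.\<close>

lemma line_function_zero_of_hyperplane_sums:
  fixes U :: "('a::{field,finite} ^ 'n::finite) set" and g :: "('a ^ 'n) set \<Rightarrow> real"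
  assumes r: "1 \<le> r" and U: "vec.subspace U" "vec.dim U = Suc r"
    and sums: "\<And>T. T \<in> subspaces_of_dim r \<Longrightarrow> T \<subseteq> U \<Longrightarrow> (\<Sum>L\<in>lines_in T. g L) = 0"
    and K: "K \<in> lines_in U"
  shows "g K = 0"
proof (cases "r = 1")
  \<comment> \<open>Here the hyperplanes of \<open>U\<close> are lines, so the hypothesis already
    evaluates \<open>g\<close>. The count below uses hyperplanes through two distinct lines, which
    requires \<open>r \<ge> 2\<close>.\<close>
  case True
  have "L = K" if "L \<in> lines_in K" for L
    using that K vec.subspace_dim_equal[of L K] by (auto simp: lines_in_def subspaces_of_dim_def)
  then have "lines_in K = {K}" using K by (auto simp: lines_in_def)
  then show ?thesis using sums[of K] K True by (simp add: lines_in_def)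
next
  case False
  let ?q = "real CARD('a)"
  let ?H = "{T \<in> subspaces_of_dim r. T \<subseteq> U}"
  let ?N = "\<lambda>i. avoiding_number ?q r 0 i (Suc r)"
  have q: "1 < ?q" using card_field_gt_1[where 'a='a] by simp
  have pos: "0 < ?N i" for i using q by (simp add: avoiding_number_pos)
  have N: "?N 2 < ?N 1"
  proof -
    have "1 < r" using False r by simp
    then have "0 < ?q ^ r - ?q ^ 1"
      using power_strict_increasing[of 1 r ?q] q by simp
    moreover have "?q ^ r < ?q ^ Suc r" using q by (intro power_strict_increasing) auto
    ultimately have "1 < (?q ^ Suc r - ?q ^ (0 + 1)) / (?q ^ r - ?q ^ 1)"
      by (simp add: less_divide_eq)
    then have "1 * ?N 2 < (?q ^ Suc r - ?q ^ (0 + 1)) / (?q ^ r - ?q ^ 1) * ?N 2"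
      using pos by (intro mult_strict_right_mono)
    then show ?thesis
      using avoiding_number_step[OF \<open>1 < r\<close>, of ?q 0 "Suc r"] by (simp add: numeral_2_eq_2)
  qed
  have count: "real (card {T \<in> ?H. W \<subseteq> T}) = ?N (vec.dim W)"
    if W: "vec.subspace W" "W \<subseteq> U" "vec.dim W \<le> r" for W
  proof -
    have "{T \<in> ?H. W \<subseteq> T} = avoiding_between r {0} W U"
      by (auto simp: avoiding_between_def subspaces_of_dim_def vec.subspace_0)
    then show ?thesis
      using card_avoiding_between[of "{0}" U W r] W U by (simp add: vec.subspace_0)
  qed
  \<comment> \<open>Summing the hypothesis over a family \<open>H\<close> of hyperplanes;
    \<open>H\<close> is first the family of all hyperplanes, then that of the hyperplanes through
    \<open>K\<close>.\<close>
  have swap: "(\<Sum>L\<in>lines_in U. real (card {T \<in> H. L \<subseteq> T}) * g L) = 0"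
    if "H \<subseteq> ?H" for H
  proof -
    have "(\<Sum>T\<in>H. \<Sum>L | L \<in> lines_in U \<and> L \<subseteq> T. g L) =
        (\<Sum>L\<in>lines_in U. \<Sum>T | T \<in> H \<and> L \<subseteq> T. g L)"
      by (rule sum.swap_restrict) auto
    moreover have "{L. L \<in> lines_in U \<and> L \<subseteq> T} = lines_in T" if "T \<in> H" for T
      using that \<open>H \<subseteq> ?H\<close> by (auto simp: lines_in_def)
    moreover have "(\<Sum>L\<in>lines_in T. g L) = 0" if "T \<in> H" for T
      using that \<open>H \<subseteq> ?H\<close> by (intro sums) auto
    ultimately show ?thesis by simp
  qed
  have "real (card {T \<in> ?H. L \<subseteq> T}) = ?N 1" if "L \<in> lines_in U" for L
    using count[of L] that r by (simp add: lines_in_def subspaces_of_dim_def)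
  then have "(\<Sum>L\<in>lines_in U. ?N 1 * g L) = 0"
    using swap[of ?H] by simp
  then have total: "(\<Sum>L\<in>lines_in U. g L) = 0"
    using pos[of 1] by (simp flip: sum_distrib_left)
  have two: "real (card {T \<in> {T \<in> ?H. K \<subseteq> T}. L \<subseteq> T}) = ?N 2 + (if L = K then ?N 1 - ?N 2 else 0)"
    if L: "L \<in> lines_in U" for L
  proof (cases "L = K")
    case True
    then have "{T \<in> {T \<in> ?H. K \<subseteq> T}. L \<subseteq> T} = {T \<in> ?H. K \<subseteq> T}" by auto
    then show ?thesis using count[of K] K True r by (simp add: lines_in_def subspaces_of_dim_def)
  next
    case False
    obtain b where b: "b \<noteq> 0" "b \<in> L" "L = vec.span {b}"
      using line_exists_generator[of L] L by (auto simp: lines_in_def)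
    have K': "vec.subspace K" "vec.dim K = 1" "K \<subseteq> U" "K \<in> subspaces_of_dim 1"
      using K by (auto simp: lines_in_def subspaces_of_dim_def)
    have "b \<notin> K" using line_eq_span[OF K'(4), of b] b False by auto
    \<comment> \<open>Distinct lines span a 2-dimensional subspace, and a hyperplane contains both
      exactly if it contains that span.\<close>
    have "{T \<in> {T \<in> ?H. K \<subseteq> T}. L \<subseteq> T} = {T \<in> ?H. vec.span (insert b K) \<subseteq> T}"
      unfolding b(3)
      by (simp add: subspaces_of_dim_def span_insert_subset_iff conj_ac cong: conj_cong)
    moreover have "vec.dim (vec.span (insert b K)) = 2"
      using dim_span_insert[OF K'(1) \<open>b \<notin> K\<close>] K' by simp
    moreover have "vec.span (insert b K) \<subseteq> U"
      using L K' b U by (auto simp: span_insert_subset_iff lines_in_def)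
    ultimately show ?thesis
      using count[of "vec.span (insert b K)"] False \<open>r \<noteq> 1\<close> r by simp
  qed
  have "real (card {T \<in> {T \<in> ?H. K \<subseteq> T}. L \<subseteq> T}) * g L =
      ?N 2 * g L + (if L = K then (?N 1 - ?N 2) * g K else 0)" if "L \<in> lines_in U" for L
    unfolding two[OF that] by (simp add: algebra_simps)
  then have "(\<Sum>L\<in>lines_in U. real (card {T \<in> {T \<in> ?H. K \<subseteq> T}. L \<subseteq> T}) * g L) =
      (\<Sum>L\<in>lines_in U. ?N 2 * g L + (if L = K then (?N 1 - ?N 2) * g K else 0))"
    by (rule sum.cong[OF refl])
  also have "\<dots> = ?N 2 * (\<Sum>L\<in>lines_in U. g L) + (?N 1 - ?N 2) * g K"
    using K by (simp add: sum.distrib flip: sum_distrib_left)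
  also have "(\<Sum>L\<in>lines_in U. real (card {T \<in> {T \<in> ?H. K \<subseteq> T}. L \<subseteq> T}) * g L) = 0"
    by (rule swap) blast
  \<comment> \<open>As \<open>g\<close> has total sum 0, only the excess of hyperplanes at
    \<open>L = K\<close> survives.\<close>
  finally have "(?N 1 - ?N 2) * g K = 0"
    using total by simp
  then show ?thesis using N by simp
qed

text \<open>The dimension bound makes the number of \<open>Suc r\<close>-subspaces through
  \<open>L\<close> that avoid \<open>S\<close> positive. All hyperplanes of such a \<open>U\<close>
  avoid \<open>S\<close> too, so the previous lemma applies inside \<open>U\<close>.\<close>

lemma line_function_zero_of_avoiding_sums:
  fixes S :: "('a::{field,finite} ^ 'n::finite) set" and g :: "('a ^ 'n) set \<Rightarrow> real"
  assumes r: "1 \<le> r" and S: "vec.subspace S" "vec.dim S + Suc r \<le> CARD('n)"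
    and sums: "\<And>T. T \<in> subspaces_of_dim r \<Longrightarrow> T \<inter> S = {0} \<Longrightarrow> (\<Sum>L\<in>lines_in T. g L) = 0"
    and L: "L \<in> subspaces_of_dim 1" "L \<inter> S = {0}"
  shows "g L = 0"
proof -
  have "real (card (avoiding_between (Suc r) S L UNIV)) =
      avoiding_number (real CARD('a)) (Suc r) (vec.dim S) 1 CARD('n)"
    using card_avoiding_between[of S UNIV L "Suc r", unfolded vec_dim_card] S L r
    by (simp add: subspaces_of_dim_def)
  also have "\<dots> > 0"
    using card_field_gt_1[where 'a='a] S by (intro avoiding_number_pos) auto
  finally have "avoiding_between (Suc r) S L UNIV \<noteq> {}" by auto
  then obtain U where U: "vec.subspace U" "vec.dim U = Suc r" "L \<subseteq> U" "U \<inter> S = {0}"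
    by (auto simp: avoiding_between_def subspaces_of_dim_def)
  show ?thesis
  proof (rule line_function_zero_of_hyperplane_sums[OF r U(1,2)])
    show "(\<Sum>L\<in>lines_in T. g L) = 0" if T: "T \<in> subspaces_of_dim r" "T \<subseteq> U" for T
    proof (rule sums)
      have "0 \<in> T" using T vec.subspace_0 by (auto simp: subspaces_of_dim_def)
      then show "T \<inter> S = {0}" using T U by auto
    qed (use T in auto)
  qed (use L U in \<open>auto simp: lines_in_def\<close>)
qed

lemma line_bilinear_zero:
  fixes R :: "('a::{field,finite} ^ 'n::finite) set \<Rightarrow> ('a ^ 'n) set \<Rightarrow> real"
  assumes r: "1 \<le> r" and n: "2 * r + 1 \<le> CARD('n)"
    and zero: "\<And>S T. S \<in> subspaces_of_dim r \<Longrightarrow> T \<in> subspaces_of_dim r \<Longrightarrow>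
      S \<inter> T = {0} \<or> S = T \<Longrightarrow> (\<Sum>L\<in>lines_in S. \<Sum>M\<in>lines_in T. R L M) = 0"
    and L: "L \<in> subspaces_of_dim 1" and M: "M \<in> subspaces_of_dim 1"
  shows "R L M = 0"
proof -
  \<comment> \<open>First application, to the function of \<open>M\<close> obtained by summing over
    the lines of \<open>S\<close>; its dimension bound is \<open>r + Suc r \<le> n\<close>.\<close>
  have row: "(\<Sum>L\<in>lines_in S. R L M) = 0"
    if S: "S \<in> subspaces_of_dim r" and M: "M \<in> subspaces_of_dim 1" "M \<inter> S = {0}" for S M
  proof (rule line_function_zero_of_avoiding_sums[OF r _ _ _ M, where g = "\<lambda>M. \<Sum>L\<in>lines_in S. R L M"])
    show "(\<Sum>M\<in>lines_in T. \<Sum>L\<in>lines_in S. R L M) = 0"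
      if "T \<in> subspaces_of_dim r" "T \<inter> S = {0}" for T
      using zero[OF S that(1)] that(2) by (subst sum.swap) (auto simp: Int_commute)
  qed (use S n in \<open>auto simp: subspaces_of_dim_def\<close>)
  \<comment> \<open>Second application, to the column of \<open>M\<close>, with the line
    \<open>M\<close> itself as the subspace to avoid.\<close>
  have off: "R L M = 0" if "L \<in> subspaces_of_dim 1" "M \<in> subspaces_of_dim 1" "L \<noteq> M" for L M
  proof (rule line_function_zero_of_avoiding_sums[OF r, where g = "\<lambda>L. R L M" and S = M])
    show "L \<inter> M = {0}"
      using that vec.subspace_dim_equal[of L M]
      by (intro line_Int_subspace) (auto simp: subspaces_of_dim_def)
    show "(\<Sum>L\<in>lines_in T. R L M) = 0" if "T \<in> subspaces_of_dim r" "T \<inter> M = {0}" for T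
      using that \<open>M \<in> subspaces_of_dim 1\<close> by (intro row) auto
  qed (use that n r in \<open>auto simp: subspaces_of_dim_def\<close>)
  \<comment> \<open>Third application, avoiding only \<open>{0}\<close>: with the off-diagonal
    entries gone, the hypothesis for \<open>S = T\<close> is a sum of diagonal entries.\<close>
  have "R L L = 0" if L: "L \<in> subspaces_of_dim 1" for L
  proof (rule line_function_zero_of_avoiding_sums[OF r _ _ _ L, where g = "\<lambda>L. R L L" and S = "{0}"])
    show "(\<Sum>L\<in>lines_in T. R L L) = 0" if T: "T \<in> subspaces_of_dim r" for T
    proof -
      have "(\<Sum>M\<in>lines_in T. R L M) = R L L" if L: "L \<in> lines_in T" for L
      proof -
        have "(\<Sum>M\<in>lines_in T. R L M) = (\<Sum>M\<in>lines_in T. if M = L then R L M else 0)"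
          using off L by (intro sum.cong) (auto simp: lines_in_def)
        then show ?thesis using L by simp
      qed
      then show ?thesis using zero[OF T T] by simp
    qed
    show "L \<inter> {0} = {0}" using L by (auto simp: subspaces_of_dim_def vec.subspace_0)
  qed (use n r in \<open>auto simp: vec.subspace_0\<close>)
  then show ?thesis using off L M by (cases "L = M") auto
qed

section \<open>Dominated frameworks\<close>

definition coordinate_vec ::
  "nat \<Rightarrow> (('a::{field,finite} ^ 'n::finite) set \<Rightarrow> 'i \<Rightarrow> real) \<Rightarrow> 'i \<Rightarrow> real ^ (('a ^ 'n) set)" where
  "coordinate_vec r p i = (\<chi> S. if S \<in> subspaces_of_dim r then p S i else 0)"

text \<open>Summation over the coordinates turns products into Gram entries, and only the entries on
  the diagonal and on edges occur: exactly those that domination constrains.\<close>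

lemma sum_qkneser_form:
  fixes p :: "('a::{field,finite} ^ 'n::finite) set \<Rightarrow> 'i \<Rightarrow> real"
  shows "(\<Sum>i\<in>I. qkneser_form r (coordinate_vec r p i)) =
    (\<Sum>S\<in>subspaces_of_dim r. \<Sum>T | T \<in> subspaces_of_dim r \<and> S \<inter> T = {0}. gram I p S T) +
    avoiding_number (real CARD('a)) r r 1 CARD('n) * (\<Sum>S\<in>subspaces_of_dim r. gram I p S S)"
proof -
  let ?V = "subspaces_of_dim r :: ('a ^ 'n) set set"
  have 1: "qkneser_op r (coordinate_vec r p i) \<bullet> coordinate_vec r p i =
      (\<Sum>S\<in>?V. \<Sum>T | T \<in> ?V \<and> S \<inter> T = {0}. p S i * p T i)" for i
    unfolding inner_vec_def qkneser_op_def
    by (rule sum.mono_neutral_cong_right)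
      (auto simp: coordinate_vec_def sum_distrib_left mult.commute intro!: sum.cong)
  have 2: "coordinate_vec r p i \<bullet> coordinate_vec r p i = (\<Sum>S\<in>?V. p S i * p S i)" for i
    unfolding inner_vec_def
    by (rule sum.mono_neutral_cong_right) (auto simp: coordinate_vec_def)
  have "(\<Sum>i\<in>I. \<Sum>S\<in>?V. \<Sum>T | T \<in> ?V \<and> S \<inter> T = {0}. p S i * p T i) =
      (\<Sum>S\<in>?V. \<Sum>T | T \<in> ?V \<and> S \<inter> T = {0}. gram I p S T)"
    unfolding gram_def by (subst sum.swap, subst (2) sum.swap) simp
  moreover have "(\<Sum>i\<in>I. \<Sum>S\<in>?V. p S i * p S i) = (\<Sum>S\<in>?V. gram I p S S)"
    unfolding gram_def by (rule sum.swap)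
  ultimately show ?thesis
    unfolding qkneser_form_def 1 2 by (simp add: sum.distrib flip: sum_distrib_left)
qed

lemma qkneser_form_coordinate_vec_nonneg:
  fixes p :: "('a::{field,finite} ^ 'n::finite) set \<Rightarrow> 'i \<Rightarrow> real"
  assumes "2 * r \<le> CARD('n)"
  shows "0 \<le> qkneser_form r (coordinate_vec r p i)"
    and "qkneser_form r (coordinate_vec r p i) = 0 \<Longrightarrow> coordinate_vec r p i \<in> inclusion_space r 1"
  using qkneser_form_inclusion_space[OF assms inclusion_space_top[of r "coordinate_vec r p i"]]
  by (auto simp: coordinate_vec_def)

text \<open>Vanishing of the form puts each coordinate function in level 1, hence makes it a sum of
  line weights \<open>y i\<close>; \<open>R\<close> is the Gram matrix of these weights.\<close>

lemma gram_from_lines: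
  fixes p :: "('a::{field,finite} ^ 'n::finite) set \<Rightarrow> 'i \<Rightarrow> real"
  assumes "1 \<le> r" "2 * r \<le> CARD('n)"
    and "\<And>i. i \<in> I \<Longrightarrow> qkneser_form r (coordinate_vec r p i) = 0"
  obtains R where "\<And>S T. S \<in> subspaces_of_dim r \<Longrightarrow> T \<in> subspaces_of_dim r \<Longrightarrow>
    gram I p S T = (\<Sum>L\<in>lines_in S. \<Sum>M\<in>lines_in T. R L M)"
proof -
  have "\<exists>y. \<forall>S\<in>subspaces_of_dim r. p S i = (\<Sum>L\<in>lines_in S. y L)" if "i \<in> I" for i
    using inclusion_space_1_lines[OF qkneser_form_coordinate_vec_nonneg(2)[OF assms(2,3)] assms(1)] that
    by (simp add: coordinate_vec_def)
  then obtain y where y: "\<And>i S. i \<in> I \<Longrightarrow> S \<in> subspaces_of_dim r \<Longrightarrow> p S i = (\<Sum>L\<in>lines_in S. y i L)"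
    by metis
  have "gram I p S T = (\<Sum>L\<in>lines_in S. \<Sum>M\<in>lines_in T. \<Sum>i\<in>I. y i L * y i M)"
    if "S \<in> subspaces_of_dim r" "T \<in> subspaces_of_dim r" for S T
  proof -
    have "gram I p S T = (\<Sum>i\<in>I. \<Sum>L\<in>lines_in S. \<Sum>M\<in>lines_in T. y i L * y i M)"
      using that y by (simp add: gram_def sum_product)
    also have "\<dots> = (\<Sum>L\<in>lines_in S. \<Sum>M\<in>lines_in T. \<Sum>i\<in>I. y i L * y i M)"
      by (subst sum.swap, subst (2) sum.swap) simp
    finally show ?thesis .
  qed
  then show ?thesis by (rule that)
qed

text \<open>The column is the combination \<open>x\<close> of the inclusion vectors of
  \<open>{0}\<close> and \<open>L\<close>, an eigenvector for the eigenvalue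
  \<open>- ?N 1\<close>.\<close>

lemma qkneser_form_P:
  fixes L :: "('a::{field,finite} ^ 'n::finite) set"
  assumes r: "1 \<le> r" and L: "L \<in> subspaces_of_dim 1"
  shows "qkneser_form r (coordinate_vec r (qkneser_P r) L) = 0"
proof -
  let ?q = "real CARD('a)"
  let ?N = "\<lambda>i. avoiding_number ?q r r i CARD('n)"
  let ?b = "\<lambda>k. q_number CARD('a) k"
  let ?x = "coordinate_vec r (qkneser_P r) L"
  let ?w = "inclusion_vec r :: ('a ^ 'n) set \<Rightarrow> _"
  have q: "1 < ?q" using card_field_gt_1[where 'a='a] by simp
  have x: "?x = ?b r *\<^sub>R ?w {0} - ?b CARD('n) *\<^sub>R ?w L"
    by (auto simp: vec_eq_iff coordinate_vec_def qkneser_P_def inclusion_vec_def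
        subspaces_of_dim_def vec.subspace_0)
  have d0: "disjointness_vec r {0} = ?w {0}"
    by (auto simp: vec_eq_iff disjointness_vec_def inclusion_vec_def subspaces_of_dim_def vec.subspace_0)
  have dL: "disjointness_vec r L $ S = (?w {0} - ?w L) $ S" for S
  proof (cases "L \<subseteq> S")
    case True
    moreover obtain b where "b \<noteq> 0" "b \<in> L" using line_exists_generator[OF L] by blast
    ultimately show ?thesis
      by (auto simp: disjointness_vec_def inclusion_vec_def subspaces_of_dim_def vec.subspace_0)
  next
    case False
    then show ?thesis using line_Int_subspace[OF L, of S]
      by (auto simp: disjointness_vec_def inclusion_vec_def subspaces_of_dim_def vec.subspace_0)
  qed
  then have dL: "disjointness_vec r L = ?w {0} - ?w L" by (simp add: vec_eq_iff)
  have N0: "?N 0 = (?q ^ CARD('n) - ?q ^ r) / (?q ^ r - 1) * ?N 1"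
    using avoiding_number_step[of 0 r ?q r "CARD('n)"] r by simp
  have "1 < ?q ^ r" using q r by (intro one_less_power) auto
  \<comment> \<open>Both sides count the pairs of a neighbour of a fixed vertex and a line in it:
    \<open>?N 0\<close> neighbours with \<open>?b r\<close> lines each, or
    \<open>?b CARD('n) - ?b r\<close> lines outside the vertex, each in \<open>?N 1\<close>
    neighbours.\<close>
  then have key: "?b r * ?N 0 = (?b CARD('n) - ?b r) * ?N 1"
    unfolding N0 using q by (simp add: q_number_def divide_simps)
  have "qkneser_op r ?x = ?b r *\<^sub>R (?N 0 *\<^sub>R ?w {0}) - ?b CARD('n) *\<^sub>R (?N 1 *\<^sub>R (?w {0} - ?w L))"
    unfolding x linear_diff[OF linear_qkneser_op] linear_scale[OF linear_qkneser_op]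
    using L r by (simp add: qkneser_op_inclusion_vec d0 dL subspaces_of_dim_def vec.subspace_0)
  also have "\<dots> = (?b r * ?N 0 - ?b CARD('n) * ?N 1) *\<^sub>R ?w {0} + (?b CARD('n) * ?N 1) *\<^sub>R ?w L"
    by (simp add: algebra_simps)
  also have "\<dots> = - (?N 1 *\<^sub>R ?x)"
    unfolding key x by (simp add: algebra_simps)
  finally show ?thesis by (simp add: qkneser_form_def)
qed

theorem theorem3p17:
  fixes G :: "(('a::{field,finite} ^ 'n::finite) set) tensegrity_graph"
    and r :: nat
  assumes "r \<ge> 1"
    and "CARD('n) \<ge> 2 * r + 1"
    and "tensegrity_graph_on (subspaces_of_dim r) (qkneser_edges r) G"
    and "cables G = {}"
  shows "universally_completable G (subspaces_of_dim 1 :: ('a ^ 'n) set set) (qkneser_P r)"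
  unfolding universally_completable_def
proof (intro allI impI)
  fix d :: nat and p' :: "('a ^ 'n) set \<Rightarrow> nat \<Rightarrow> real"
  let ?V = "subspaces_of_dim r :: ('a ^ 'n) set set"
  let ?I = "subspaces_of_dim 1 :: ('a ^ 'n) set set"
  let ?E = "\<lambda>S. {T. T \<in> ?V \<and> S \<inter> T = {0}}"
  let ?M = "gram ?I (qkneser_P r)" and ?Y = "gram {..<d} p'"
  let ?form = "\<lambda>i. qkneser_form r (coordinate_vec r p' i)"
  assume "dominates G ?I (qkneser_P r) {..<d} p'"
  then have diag: "\<And>S. S \<in> ?V \<Longrightarrow> ?Y S S = ?M S S"
    and bar: "\<And>S T. {S, T} \<in> bars G \<Longrightarrow> ?Y S T = ?M S T"
    and strut: "\<And>S T. {S, T} \<in> struts G \<Longrightarrow> ?Y S T \<le> ?M S T"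
    using assms(3) unfolding dominates_def tensegrity_graph_on_def by blast+
  \<comment> \<open>Without cables every edge is a bar or a strut, and both give the upper
    bound.\<close>
  have edge: "?Y S T \<le> ?M S T" if "S \<in> ?V" "T \<in> ?E S" for S T
  proof -
    have "{S, T} \<in> qkneser_edges r"
      using that unfolding qkneser_edges_def by blast
    then have "{S, T} \<in> bars G \<union> struts G"
      using assms(3,4) by (simp add: tensegrity_graph_on_def)
    then show ?thesis using bar[of S T] strut[of S T] by (elim UnE) simp_all
  qed
  have n: "2 * r \<le> CARD('n)" using assms(2) by simp
  have P: "(\<Sum>L\<in>?I. qkneser_form r (coordinate_vec r (qkneser_P r) L)) = 0"
    using assms(1) by (simp add: qkneser_form_P)
  \<comment> \<open>The diagonals agree and the form sums to 0 over the columns of \<open>P\<close>,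
    so only the edge differences remain. The left side is nonnegative and the right side
    nonpositive, so both vanish.\<close>
  have "(\<Sum>i<d. ?form i) = (\<Sum>S\<in>?V. \<Sum>T\<in>?E S. ?Y S T - ?M S T)"
    using sum_qkneser_form[of r p' "{..<d}"] sum_qkneser_form[of r "qkneser_P r" ?I] P diag
    by (simp add: sum_subtractf)
  moreover have "(\<Sum>S\<in>?V. \<Sum>T\<in>?E S. ?Y S T - ?M S T) \<le> 0"
    using edge by (intro sum_nonpos) auto
  moreover have "0 \<le> (\<Sum>i<d. ?form i)"
    using n by (intro sum_nonneg qkneser_form_coordinate_vec_nonneg)
  ultimately have form0: "(\<Sum>i<d. ?form i) = 0"
    and edges0: "(\<Sum>S\<in>?V. \<Sum>T\<in>?E S. ?M S T - ?Y S T) = 0"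
    by (simp_all add: sum_subtractf)
  have "?form i = 0" if "i \<in> {..<d}" for i
    by (rule sum_nonneg_0[OF finite_lessThan qkneser_form_coordinate_vec_nonneg(1)[OF n] form0 that])
  from gram_from_lines[OF assms(1) n this]
  obtain R where R: "\<And>S T. S \<in> ?V \<Longrightarrow> T \<in> ?V \<Longrightarrow>
    ?Y S T = (\<Sum>L\<in>lines_in S. \<Sum>M\<in>lines_in T. R L M)" by blast
  from gram_from_lines[OF assms(1) n qkneser_form_P[OF assms(1)], of ?I]
  obtain R' where R': "\<And>S T. S \<in> ?V \<Longrightarrow> T \<in> ?V \<Longrightarrow>
    ?M S T = (\<Sum>L\<in>lines_in S. \<Sum>M\<in>lines_in T. R' L M)" by blast
  \<comment> \<open>A vanishing sum of nonnegative terms, used for the outer and then for the inner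
    sum.\<close>
  have "?M S T - ?Y S T = 0" if "S \<in> ?V" "T \<in> ?E S" for S T
  proof -
    have "(\<Sum>T\<in>?E S. ?M S T - ?Y S T) = 0"
      by (rule sum_nonneg_0[OF finite _ edges0 that(1)]) (use edge in \<open>auto intro!: sum_nonneg\<close>)
    from sum_nonneg_0[OF finite _ this that(2)] show ?thesis
      using edge that(1) by simp
  qed
  \<comment> \<open>Domination fixes the diagonal and the previous step the edges, so
    \<open>R - R'\<close> satisfies the hypothesis of \<open>line_bilinear_zero\<close>.\<close>
  then have "(\<Sum>L\<in>lines_in S. \<Sum>M\<in>lines_in T. R L M - R' L M) = 0"
    if "S \<in> ?V" "T \<in> ?V" "S \<inter> T = {0} \<or> S = T" for S T
    using that diag R[of S T] R'[of S T] by (auto simp: sum_subtractf)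
  then have "R L M - R' L M = 0" if "L \<in> ?I" "M \<in> ?I" for L M
    using line_bilinear_zero[OF assms(1,2), of "\<lambda>L M. R L M - R' L M"] that by blast
  then have "?Y S T = ?M S T" if "S \<in> ?V" "T \<in> ?V" for S T
    using that R R' by (auto simp: lines_in_def intro!: sum.cong)
  then show "\<forall>S\<in>verts G. \<forall>T\<in>verts G. ?Y S T = ?M S T"
    using assms(3) by (simp add: tensegrity_graph_on_def)
qed

end
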